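(* Let $\mathcal{F}=\{\hat f^T_\theta\}_{\theta\in\Theta}$ denote the semisupervised kernel estimators trained on data $T$ using $\theta\in\Theta$, where $\Theta$ is finite with $J=|\Theta|$. Use the validation data $V$ to pick $$\hat\theta=\operatorname{arg\,min}_{\theta\in\Theta}\hat R^V(\hat f^T_\theta)$$ and define the corresponding estimator $\hat f=\hat f^T_{\hat\theta}$. Then there are constants $0<a<1$ and $0<t<\frac{15}{38(M^2+\tau^2)}$ (depending only on $M$ and $\tau$) such that for every $0<\delta<1$, $$\mathbb{E}\left[\mathcal{E}(\hat f^T_{\hat\theta})\right]\le\frac{1}{1-a}\left[\min_{\theta\in\Theta}\mathbb{E}\left[\mathcal{E}(\hat f^T_\theta)\right]+\frac{\log(J/\delta)}{nt}\right]+4\delta M^2,$$ where $\mathbb{E}$ denotes expectation over everything that is random.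
   Context: Model: $(X,Y)$ satisfies $Y=f^*(X)+\epsilon$ with $\epsilon\sim N(0,\tau^2)$ independent of $X$, where $f^*$ is the true regression function and $X\in[0,1]^d$. The labeled data are i.i.d. copies of $(X,Y)$, split into independent training data $T$ and validation data $V$, each of size $n$; there are also $m$ unlabeled points, i.i.d. from the marginal of $X$ and independent of $T$ and $V$. For any $f$, the risk is $R(f)=\mathbb{E}[(f(X)-Y)^2]$ and the excess risk is $\mathcal{E}(f)=R(f)-R(f^* )=\mathbb{E}[(f(X)-f^*(X))^2]$ ($(X,Y)$ a fresh copy). The empirical validation risk is $\hat R^V(f)=\frac1n\sum_{(X_i,Y_i)\in V}(f(X_i)-Y_i)^2$. It is assumed that $|f^*(x)|\le M$ and $|\hat f^T_\theta(x)|\le M$ for all $x$ and $\theta$, with $M>0$ a constant. Estimators: $\Theta=\mathcal{H}\times\mathcal{A}\times\Sigma$ where $\mathcal{H}$ is a finite set of bandwidths $h>0$, $\mathcal{A}$ a finite set of values $\alpha\ge0$, $\Sigma$ a finite set of values $\sigma>0$. For $\theta=(h,\alpha,\sigma)$, $$\hat f^T_\theta(x)=\frac{\sum_{i\in T}Y_i\,Q_h(\hat D_{\alpha,\sigma}(x,X_i))}{\sum_{i\in T}Q_h(\hat D_{\alpha,\sigma}(x,X_i))}$$ (truncated if necessary so that it is bounded by $M$), where $Q$ is a kernel, $Q_h(x)=h^{-d}Q(x/h)$, and $\hat D_{\alpha,\sigma}(x_1,x_2)=\inf_{\gamma}\int_0^{L(\gamma)}\exp[-\alpha\hat p_\sigma(\gamma(t))]\,dt$,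 the infimum being over continuous finite-length unit-speed curves $\gamma$ from $x_1$ to $x_2$ with length $L(\gamma)$; here $\hat p_\sigma(x)=\frac1m\sum_j\sigma^{-d}K(\|x-X_j\|/\sigma)$, the sum over the unlabeled points, with $K$ a symmetric compactly supported kernel on $\mathbb{R}^d$. *)

theory Defs
  imports "HOL-Probability.Probability"
begin

text \<open>The constants of the theorem must not depend on the dimension \<open>d\<close>, so \<open>d\<close> is quantified inside
  the formula and cannot be a type.  A point of \<open>\<real>\<^sup>d\<close> is therefore a function \<open>x :: nat \<Rightarrow> real\<close> of
  which only the coordinates \<open>x i\<close> with \<open>i < d\<close> matter.\<close>

type_synonym pt = "nat \<Rightarrow> real"

definition pdist :: "nat \<Rightarrow> pt \<Rightarrow> pt \<Rightarrow> real" where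
  "pdist d x y = L2_set (\<lambda>i. x i - y i) {..<d}"

text \<open>The cube \<open>[0,1]\<^sup>d\<close> with its Borel sets; its underlying set is \<open>{..<d} \<rightarrow>\<^sub>E {0..1}\<close>.\<close>

definition cube :: "nat \<Rightarrow> pt measure" where
  "cube d = (\<Pi>\<^sub>M i\<in>{..<d}. restrict_space borel {0..1})"


subsection \<open>The regression model and the data\<close>

text \<open>Law of \<open>(X, Y)\<close> where \<open>X\<close> has law \<open>PX\<close>, \<open>Y = f X + \<epsilon>\<close> and \<open>\<epsilon> \<sim> N(0, \<tau>\<^sup>2)\<close> is independent
  of \<open>X\<close>.  The second parameter of \<open>normal_density\<close> is the standard deviation.\<close>

definition model_law :: "pt measure \<Rightarrow> (pt \<Rightarrow> real) \<Rightarrow> real \<Rightarrow> (pt \<times> real) measure" where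
  "model_law PX f \<tau> =
     distr (PX \<Otimes>\<^sub>M density lborel (normal_density 0 \<tau>)) (PX \<Otimes>\<^sub>M borel) (\<lambda>(x, e). (x, f x + e))"

text \<open>Joint law of the training data \<open>T\<close>, the validation data \<open>V\<close> (\<open>n\<close> labeled points each) and
  the \<open>m\<close> unlabeled points \<open>U\<close>, all independent.\<close>

definition data_law ::
  "nat \<Rightarrow> nat \<Rightarrow> pt measure \<Rightarrow> (pt \<Rightarrow> real) \<Rightarrow> real
    \<Rightarrow> ((nat \<Rightarrow> pt \<times> real) \<times> (nat \<Rightarrow> pt \<times> real) \<times> (nat \<Rightarrow> pt)) measure" where
  "data_law n m PX f \<tau> =
     (\<Pi>\<^sub>M i\<in>{..<n}. model_law PX f \<tau>) \<Otimes>\<^sub>M (\<Pi>\<^sub>M i\<in>{..<n}. model_law PX f \<tau>) \<Otimes>\<^sub>M (\<Pi>\<^sub>M j\<in>{..<m}. PX)"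

definition risk :: "(pt \<times> real) measure \<Rightarrow> (pt \<Rightarrow> real) \<Rightarrow> real" where
  "risk P f = (\<integral>(x, y). (f x - y)\<^sup>2 \<partial>P)"

definition excess_risk :: "pt measure \<Rightarrow> (pt \<Rightarrow> real) \<Rightarrow> real \<Rightarrow> (pt \<Rightarrow> real) \<Rightarrow> real" where
  "excess_risk PX fstar \<tau> f = risk (model_law PX fstar \<tau>) f - risk (model_law PX fstar \<tau>) fstar"

definition empirical_risk :: "nat \<Rightarrow> (nat \<Rightarrow> pt \<times> real) \<Rightarrow> (pt \<Rightarrow> real) \<Rightarrow> real" where
  "empirical_risk n V f = (\<Sum>i<n. (f (fst (V i)) - snd (V i))\<^sup>2) / real n"


subsection \<open>The density-sensitive distance\<close>

text \<open>Radial profile \<open>K\<close> of a symmetric, compactly supported kernel \<open>x \<mapsto> K \<parallel>x\<parallel>\<close> on \<open>\<real>\<^sup>d\<close>.\<close>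

definition density_kernel :: "nat \<Rightarrow> (real \<Rightarrow> real) \<Rightarrow> bool" where
  "density_kernel d K \<longleftrightarrow>
     K \<in> borel_measurable borel \<and> (\<forall>u. 0 \<le> K u) \<and> (\<forall>u. K (- u) = K u) \<and>
     compact (closure {u. K u \<noteq> 0}) \<and>
     (\<integral>x. K (L2_set x {..<d}) \<partial>(\<Pi>\<^sub>M i\<in>{..<d}. lborel)) = 1"

text \<open>The kernel of the regression estimator is only evaluated at distances.  No normalization is
  imposed on it, since the estimator is invariant under rescaling of \<open>Q\<close>.\<close>

definition weight_kernel :: "(real \<Rightarrow> real) \<Rightarrow> bool" where
  "weight_kernel Q \<longleftrightarrow> Q \<in> borel_measurable borel \<and> (\<forall>u. 0 \<le> Q u)"

definition density_est :: "nat \<Rightarrow> nat \<Rightarrow> (real \<Rightarrow> real) \<Rightarrow> (nat \<Rightarrow> pt) \<Rightarrow> real \<Rightarrow> pt \<Rightarrow> real" where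
  "density_est d m K U \<sigma> x = (\<Sum>j<m. K (pdist d x (U j) / \<sigma>) / \<sigma> ^ d) / real m"

text \<open>Length of the curve \<open>\<gamma>\<close> between the parameters \<open>a\<close> and \<open>b\<close>, as the supremum over inscribed
  polygons with vertices \<open>\<gamma> (p 0), \<dots>, \<gamma> (p k)\<close>.  It is taken in \<open>ennreal\<close> so that
  non-rectifiable curves have length \<open>\<infinity>\<close>.\<close>

definition arc_length :: "nat \<Rightarrow> (real \<Rightarrow> pt) \<Rightarrow> real \<Rightarrow> real \<Rightarrow> ennreal" where
  "arc_length d \<gamma> a b =
     (SUP (k, p) \<in> {(k :: nat, p). mono_on {..k} p \<and> p ` {..k} \<subseteq> {a..b}}.
        ennreal (\<Sum>i<k. pdist d (\<gamma> (p i)) (\<gamma> (p (Suc i)))))"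

text \<open>Continuous finite-length unit-speed curves \<open>\<gamma> : [0,L] \<rightarrow> \<real>\<^sup>d\<close> from \<open>x\<close> to \<open>y\<close>.  Unit speed means
  parametrization by arc length, so \<open>L\<close> is the length of \<open>\<gamma>\<close>.\<close>

definition unit_speed_curve :: "nat \<Rightarrow> pt \<Rightarrow> pt \<Rightarrow> real \<Rightarrow> (real \<Rightarrow> pt) \<Rightarrow> bool" where
  "unit_speed_curve d x y L \<gamma> \<longleftrightarrow>
     0 \<le> L \<and> (\<forall>i<d. continuous_on {0..L} (\<lambda>s. \<gamma> s i)) \<and>
     (\<forall>i<d. \<gamma> 0 i = x i) \<and> (\<forall>i<d. \<gamma> L i = y i) \<and>
     (\<forall>s r. 0 \<le> s \<and> s \<le> r \<and> r \<le> L \<longrightarrow> arc_length d \<gamma> s r = ennreal (r - s))"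

definition density_dist ::
  "nat \<Rightarrow> nat \<Rightarrow> (real \<Rightarrow> real) \<Rightarrow> (nat \<Rightarrow> pt) \<Rightarrow> real \<Rightarrow> real \<Rightarrow> pt \<Rightarrow> pt \<Rightarrow> real" where
  "density_dist d m K U \<alpha> \<sigma> x y =
     Inf {LBINT s:{0..L}. exp (- \<alpha> * density_est d m K U \<sigma> (\<gamma> s)) | L \<gamma>. unit_speed_curve d x y L \<gamma>}"


subsection \<open>The semisupervised kernel estimator\<close>

definition clip :: "real \<Rightarrow> real \<Rightarrow> real" where
  "clip M y = max (- M) (min M y)"

definition scaled_kernel :: "nat \<Rightarrow> (real \<Rightarrow> real) \<Rightarrow> real \<Rightarrow> real \<Rightarrow> real" where
  "scaled_kernel d Q h u = Q (u / h) / h ^ d"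

text \<open>Training data \<open>T\<close>, unlabeled points \<open>U\<close>, parameter \<open>\<theta> = (h, \<alpha>, \<sigma>)\<close>.  The value is \<open>0\<close> where
  all weights vanish, by \<open>0 / 0 = 0\<close>.\<close>

definition ss_estimator ::
  "nat \<Rightarrow> nat \<Rightarrow> nat \<Rightarrow> real \<Rightarrow> (real \<Rightarrow> real) \<Rightarrow> (real \<Rightarrow> real)
    \<Rightarrow> (nat \<Rightarrow> pt \<times> real) \<Rightarrow> (nat \<Rightarrow> pt) \<Rightarrow> real \<times> real \<times> real \<Rightarrow> pt \<Rightarrow> real" where
  "ss_estimator d n m M Q K T U \<theta> x =
     (case \<theta> of (h, \<alpha>, \<sigma>) \<Rightarrow>
        let w = (\<lambda>i. scaled_kernel d Q h (density_dist d m K U \<alpha> \<sigma> x (fst (T i))))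
        in clip M ((\<Sum>i<n. snd (T i) * w i) / (\<Sum>i<n. w i)))"

end

theory Submission
  imports Defs
begin

text \<open>
Write \<open>\<E>(g)\<close> for the excess risk and \<open>E\<^sub>V(g)\<close> for its empirical counterpart on the validation
data, the mean of the loss differences \<open>(g(X) - Y)\<^sup>2 - (f\<^sup>*(X) - Y)\<^sup>2\<close>.  Minimizing the empirical
risk is the same as minimizing \<open>E\<^sub>V\<close>, and \<open>E\<^sub>V(g)\<close> has mean \<open>\<E>(g)\<close> when \<open>g\<close> is fixed.  Everything is
done conditionally on the training and unlabeled data, which are independent of the validation
data and turn the estimators into a fixed finite family of functions bounded by \<open>M\<close>.

With \<open>\<Delta> = g(X) - f\<^sup>*(X)\<close>, a loss difference equals \<open>\<Delta>\<^sup>2 - 2 \<Delta> \<epsilon>\<close>.  Its fluctuation is therefore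
controlled by its own mean \<open>\<E>(g) = \<bbbE> \<Delta>\<^sup>2\<close>: integrating \<open>exp (- t (\<Delta>\<^sup>2 - 2 \<Delta> \<epsilon>))\<close> over the Gaussian
noise gives \<open>exp (- t (1 - 2 t \<tau>\<^sup>2) \<Delta>\<^sup>2)\<close>, and since \<open>\<Delta>\<^sup>2 \<le> 4 M\<^sup>2\<close> the expectation of that is at most
\<open>exp (- t (1 - a) \<E>(g))\<close> as soon as \<open>1 - a \<le> (1 - 2 t \<tau>\<^sup>2) (1 - 2 t M\<^sup>2)\<close> (\<open>exp_loss_diff_bound\<close>).
By independence, \<open>W(g) = n t ((1 - a) \<E>(g) - E\<^sub>V(g))\<close> satisfies \<open>\<bbbE> exp W(g) \<le> 1\<close>
(\<open>exp_sample_bound\<close>).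

From \<open>u \<le> exp u - 1\<close> with \<open>u = W(g) - ln J\<close>, summed over the family, the largest of the \<open>J\<close>
values \<open>W(g)\<close> has expectation at most \<open>ln J\<close>, so this bound applies to the selected function,
however the selection depends on the data.  Its \<open>E\<^sub>V\<close> is at most that of any fixed member \<open>g\<close>, whose
expectation is \<open>\<E>(g)\<close>.  Thus \<open>(1 - a) \<bbbE> \<E>(selected) \<le> \<E>(g) + ln J / (n t)\<close>
(\<open>selection_oracle_inequality\<close>); only this one-sided deviation bound enters.  Integrating over the
training and unlabeled data (\<open>trained_selection_oracle_inequality\<close>), bounding \<open>ln J\<close> by
\<open>ln (J / \<delta>)\<close> and taking \<open>a = 1/2\<close>, \<open>t = 1 / (8 (M\<^sup>2 + \<tau>\<^sup>2))\<close> gives the theorem.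
\<close>

section \<open>Exponential estimates and conditional integration\<close>

lemma exp_minus_le_quadratic:
  fixes v :: real
  assumes "0 \<le> v"
  shows "exp (- v) \<le> 1 - v + v\<^sup>2 / 2"
proof -
  have "0 < 1 + v + v\<^sup>2 / 2"
    using assms by (simp add: add_pos_nonneg)
  moreover have "1 + v + v\<^sup>2 / 2 \<le> exp v"
    using exp_lower_Taylor_quadratic[OF assms] by simp
  ultimately have "exp (- v) \<le> 1 / (1 + v + v\<^sup>2 / 2)"
    by (simp add: exp_minus inverse_eq_divide frac_le)
  also have "\<dots> \<le> 1 - v + v\<^sup>2 / 2"
  proof -
    \<comment> \<open>The second-order expansions of \<open>exp v\<close> and \<open>exp (- v)\<close> have product at least \<open>1\<close>.\<close>
    have "(1 - v + v\<^sup>2 / 2) * (1 + v + v\<^sup>2 / 2) = 1 + v ^ 4 / 4"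
      by (simp add: algebra_simps power2_eq_square power4_eq_xxxx)
    then show ?thesis
      using \<open>0 < 1 + v + v\<^sup>2 / 2\<close> by (simp add: divide_le_eq)
  qed
  finally show ?thesis .
qed

text \<open>Completing the square: tilting a centered normal density by \<open>exp (c e)\<close> yields, up to the
  constant factor, the normal density with mean \<open>c \<tau>\<^sup>2\<close>.\<close>

lemma nn_integral_exp_normal:
  assumes "0 < \<tau>"
  shows "(\<integral>\<^sup>+ e. ennreal (exp (c * e)) \<partial>density lborel (normal_density 0 \<tau>))
    = ennreal (exp (c\<^sup>2 * \<tau>\<^sup>2 / 2))"
proof -
  have eq: "normal_density 0 \<tau> e * exp (c * e)
      = exp (c\<^sup>2 * \<tau>\<^sup>2 / 2) * normal_density (c * \<tau>\<^sup>2) \<tau> e" for e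
  proof -
    have "- (e - 0)\<^sup>2 / (2 * \<tau>\<^sup>2) + c * e = c\<^sup>2 * \<tau>\<^sup>2 / 2 + - (e - c * \<tau>\<^sup>2)\<^sup>2 / (2 * \<tau>\<^sup>2)"
      using assms by (simp add: field_simps power2_eq_square)
    then show ?thesis
      unfolding normal_density_def by (simp flip: exp_add)
  qed
  interpret prob_space "density lborel (normal_density (c * \<tau>\<^sup>2) \<tau>)"
    by (rule prob_space_normal_density) fact
  have total: "(\<integral>\<^sup>+ e. ennreal (normal_density (c * \<tau>\<^sup>2) \<tau> e) \<partial>lborel) = 1"
    using emeasure_space_1 by (simp add: emeasure_density)
  have "(\<integral>\<^sup>+ e. ennreal (exp (c * e)) \<partial>density lborel (normal_density 0 \<tau>))
      = (\<integral>\<^sup>+ e. ennreal (exp (c\<^sup>2 * \<tau>\<^sup>2 / 2)) * ennreal (normal_density (c * \<tau>\<^sup>2) \<tau> e) \<partial>lborel)"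
    by (subst nn_integral_density) (auto simp: eq simp flip: ennreal_mult')
  then show ?thesis
    by (simp add: nn_integral_cmult total)
qed

text \<open>Integrals over three independent components can be compared conditionally on the first and the
  third one.  The components are the training, validation and unlabeled data.\<close>

lemma integral_mono_conditional:
  fixes h k :: "'a \<times> 'b \<times> 'c \<Rightarrow> real"
  assumes "prob_space A" "prob_space B" "prob_space C"
    and h: "h \<in> borel_measurable (A \<Otimes>\<^sub>M B \<Otimes>\<^sub>M C)"
    and k: "k \<in> borel_measurable (A \<Otimes>\<^sub>M B \<Otimes>\<^sub>M C)"
    and h_bound: "\<And>z. z \<in> space (A \<Otimes>\<^sub>M B \<Otimes>\<^sub>M C) \<Longrightarrow> \<bar>h z\<bar> \<le> b"
    and k_bound: "\<And>z. z \<in> space (A \<Otimes>\<^sub>M B \<Otimes>\<^sub>M C) \<Longrightarrow> \<bar>k z\<bar> \<le> b"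
    and le: "\<And>x z. x \<in> space A \<Longrightarrow> z \<in> space C \<Longrightarrow>
      (\<integral>y. h (x, y, z) \<partial>B) \<le> (\<integral>y. k (x, y, z) \<partial>B)"
  shows "integral\<^sup>L (A \<Otimes>\<^sub>M B \<Otimes>\<^sub>M C) h \<le> integral\<^sup>L (A \<Otimes>\<^sub>M B \<Otimes>\<^sub>M C) k"
proof -
  interpret BC: pair_prob_space B C
    using assms by (simp add: pair_prob_space_def pair_sigma_finite_def prob_space_imp_sigma_finite)
  interpret ABC: pair_prob_space A "B \<Otimes>\<^sub>M C"
    using assms BC.prob_space_axioms
    by (simp add: pair_prob_space_def pair_sigma_finite_def prob_space_imp_sigma_finite)
  have total: "integrable (A \<Otimes>\<^sub>M B \<Otimes>\<^sub>M C) h" "integrable (A \<Otimes>\<^sub>M B \<Otimes>\<^sub>M C) k"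
    using h k h_bound k_bound by (auto intro!: ABC.integrable_const_bound[where B = b])
  have slice: "(\<integral>w. h (x, w) \<partial>(B \<Otimes>\<^sub>M C)) \<le> (\<integral>w. k (x, w) \<partial>(B \<Otimes>\<^sub>M C))" if x: "x \<in> space A" for x
  proof -
    have *: "integrable (B \<Otimes>\<^sub>M C) (\<lambda>w. h (x, w))" "integrable (B \<Otimes>\<^sub>M C) (\<lambda>w. k (x, w))"
      using h k h_bound k_bound x
      by (auto intro!: BC.integrable_const_bound[where B = b] simp: space_pair_measure)
    have "(\<integral>z. \<integral>y. h (x, y, z) \<partial>B \<partial>C) \<le> (\<integral>z. \<integral>y. k (x, y, z) \<partial>B \<partial>C)"
      using BC.integrable_snd[of "\<lambda>y z. h (x, y, z)"] BC.integrable_snd[of "\<lambda>y z. k (x, y, z)"] *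
      by (intro integral_mono le x) (simp_all add: split_def)
    then show ?thesis
      using BC.integral_snd[of "\<lambda>y z. h (x, y, z)"] BC.integral_snd[of "\<lambda>y z. k (x, y, z)"] *
      by (simp add: split_def)
  qed
  have "(\<integral>x. \<integral>w. h (x, w) \<partial>(B \<Otimes>\<^sub>M C) \<partial>A) \<le> (\<integral>x. \<integral>w. k (x, w) \<partial>(B \<Otimes>\<^sub>M C) \<partial>A)"
    by (intro integral_mono ABC.integrable_fst' total slice)
  then show ?thesis
    using ABC.integral_fst'[OF total(1)] ABC.integral_fst'[OF total(2)] by simp
qed

section \<open>Loss differences in the regression model\<close>

locale bounded_regression = prob_space PX for PX :: "pt measure" +
  fixes fstar :: "pt \<Rightarrow> real" and \<tau> M :: real
  assumes fstar_measurable[measurable]: "fstar \<in> borel_measurable PX"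
    and fstar_bound: "\<And>x. x \<in> space PX \<Longrightarrow> \<bar>fstar x\<bar> \<le> M"
    and \<tau>_pos: "0 < \<tau>"
begin

abbreviation noise :: "real measure" where
  "noise \<equiv> density lborel (normal_density 0 \<tau>)"

abbreviation P :: "(pt \<times> real) measure" where
  "P \<equiv> model_law PX fstar \<tau>"

abbreviation excess :: "(pt \<Rightarrow> real) \<Rightarrow> real" where
  "excess \<equiv> excess_risk PX fstar \<tau>"

definition loss_diff :: "(pt \<Rightarrow> real) \<Rightarrow> pt \<times> real \<Rightarrow> real" where
  "loss_diff g z = (g (fst z) - snd z)\<^sup>2 - (fstar (fst z) - snd z)\<^sup>2"

definition admissible :: "(pt \<Rightarrow> real) \<Rightarrow> bool" where
  "admissible g \<longleftrightarrow> g \<in> borel_measurable PX \<and> (\<forall>x\<in>space PX. \<bar>g x\<bar> \<le> M)"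

sublocale noise: prob_space noise
  by (rule prob_space_normal_density) (rule \<tau>_pos)

sublocale joint: pair_prob_space PX noise ..

lemma admissible_fstar: "admissible fstar"
  by (simp add: admissible_def fstar_bound)

lemma sets_P[measurable_cong]: "sets P = sets (PX \<Otimes>\<^sub>M borel)"
  by (simp add: model_law_def)

lemma draw_measurable[measurable]:
  "(\<lambda>(x, e). (x, fstar x + e)) \<in> PX \<Otimes>\<^sub>M noise \<rightarrow>\<^sub>M PX \<Otimes>\<^sub>M borel"
  by measurable

lemma prob_space_P: "prob_space P"
  unfolding model_law_def by (rule joint.prob_space_distr) (rule draw_measurable)

lemma admissible_measurable: "admissible g \<Longrightarrow> g \<in> borel_measurable PX"
  by (simp add: admissible_def)

lemma integrable_noise: "integrable noise (\<lambda>e. e)" "integrable noise (\<lambda>e. e\<^sup>2)"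
  using integrable_normal_moment_nz_1[OF \<tau>_pos, of 0] integrable_normal_moment[OF \<tau>_pos, of 0 2]
  by (simp_all add: integrable_density)

lemma noise_mean: "(\<integral>e. e \<partial>noise) = 0"
  using integral_normal_moment_nz_1[OF \<tau>_pos, of 0] by (simp add: integral_density)

lemma square_gap_bound:
  assumes "admissible g" "x \<in> space PX"
  shows "(g x - fstar x)\<^sup>2 \<le> 4 * M\<^sup>2"
proof -
  have "\<bar>g x - fstar x\<bar> \<le> 2 * M"
    using assms fstar_bound[of x] unfolding admissible_def by fastforce
  then have "(g x - fstar x)\<^sup>2 \<le> (2 * M)\<^sup>2"
    by (rule abs_le_square_iff[THEN iffD1, OF order_trans]) simp
  then show ?thesis by simp
qed

lemma integrable_square_gap:
  assumes "admissible g"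
  shows "integrable PX (\<lambda>x. (g x - fstar x)\<^sup>2)"
  using assms admissible_measurable[OF assms] square_gap_bound[OF assms]
  by (intro integrable_const_bound[where B = "4 * M\<^sup>2"]) auto

lemma integrable_joint_noise:
  fixes u :: "real \<Rightarrow> real"
  assumes "integrable noise u"
  shows "integrable (PX \<Otimes>\<^sub>M noise) (\<lambda>z. u (snd z))"
  using assms borel_measurable_integrable[OF assms] by (intro joint.Fubini_integrable) auto

lemma integrable_gap_times_noise:
  assumes "admissible g"
  shows "integrable (PX \<Otimes>\<^sub>M noise) (\<lambda>z. (g (fst z) - fstar (fst z)) * snd z)"
proof (rule Bochner_Integration.integrable_bound)
  note admissible_measurable[OF assms, measurable]
  show "integrable (PX \<Otimes>\<^sub>M noise) (\<lambda>z. 2 * M * \<bar>snd z\<bar>)"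
    using integrable_joint_noise[OF integrable_noise(1)] by auto
  show "(\<lambda>z. (g (fst z) - fstar (fst z)) * snd z) \<in> borel_measurable (PX \<Otimes>\<^sub>M noise)"
    by measurable
  show "AE z in PX \<Otimes>\<^sub>M noise. norm ((g (fst z) - fstar (fst z)) * snd z) \<le> norm (2 * M * \<bar>snd z\<bar>)"
  proof (rule AE_I2)
    fix z assume z: "z \<in> space (PX \<Otimes>\<^sub>M noise)"
    have "\<bar>g (fst z) - fstar (fst z)\<bar> \<le> \<bar>2 * M\<bar>"
      using assms fstar_bound[of "fst z"] z unfolding admissible_def
      by (fastforce simp: space_pair_measure)
    then show "norm ((g (fst z) - fstar (fst z)) * snd z) \<le> norm (2 * M * \<bar>snd z\<bar>)"
      by (simp add: abs_mult mult_right_mono)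
  qed
qed

lemma integrable_loss:
  assumes "admissible g"
  shows "integrable P (\<lambda>z. (g (fst z) - snd z)\<^sup>2)"
proof -
  note admissible_measurable[OF assms, measurable]
  have "integrable (PX \<Otimes>\<^sub>M noise) (\<lambda>z. (g (fst z) - fstar (fst z))\<^sup>2)"
    using integrable_square_gap[OF assms] by (intro joint.Fubini_integrable) auto
  then have "integrable (PX \<Otimes>\<^sub>M noise)
      (\<lambda>z. (g (fst z) - fstar (fst z))\<^sup>2 - 2 * ((g (fst z) - fstar (fst z)) * snd z) + (snd z)\<^sup>2)"
    using integrable_gap_times_noise[OF assms] integrable_joint_noise[OF integrable_noise(2)]
    by (intro Bochner_Integration.integrable_add Bochner_Integration.integrable_diff
        integrable_mult_right) auto
  also have "(\<lambda>z. (g (fst z) - fstar (fst z))\<^sup>2 - 2 * ((g (fst z) - fstar (fst z)) * snd z) + (snd z)\<^sup>2)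
      = (\<lambda>z. (g (fst z) - (fstar (fst z) + snd z))\<^sup>2)"
    by (auto simp: power2_eq_square algebra_simps)
  finally show ?thesis
    unfolding model_law_def by (subst integrable_distr_eq) (auto simp: split_def)
qed

lemma integrable_loss_diff: "admissible g \<Longrightarrow> integrable P (loss_diff g)"
  unfolding loss_diff_def[abs_def]
  by (intro Bochner_Integration.integrable_diff integrable_loss admissible_fstar)

lemma excess_eq_loss_diff: "admissible g \<Longrightarrow> excess g = (\<integral>z. loss_diff g z \<partial>P)"
  unfolding excess_risk_def risk_def loss_diff_def
  by (subst Bochner_Integration.integral_diff) (auto simp: split_def integrable_loss admissible_fstar)

text \<open>The cross term \<open>2 \<Delta> \<epsilon>\<close> has mean zero, the noise being centered and independent of \<open>X\<close>.\<close>

lemma excess_eq: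
  assumes "admissible g"
  shows "excess g = (\<integral>x. (g x - fstar x)\<^sup>2 \<partial>PX)"
proof -
  note [measurable] = admissible_measurable[OF assms]
  let ?gap = "\<lambda>x. g x - fstar x"
  have gap: "integrable (PX \<Otimes>\<^sub>M noise) (\<lambda>z. (?gap (fst z))\<^sup>2)"
    using integrable_square_gap[OF assms] by (intro joint.Fubini_integrable) auto
  have "excess g = (\<integral>z. (?gap (fst z))\<^sup>2 - 2 * (?gap (fst z) * snd z) \<partial>(PX \<Otimes>\<^sub>M noise))"
    unfolding excess_eq_loss_diff[OF assms] model_law_def loss_diff_def
    by (subst integral_distr)
      (auto intro!: Bochner_Integration.integral_cong simp: split_def power2_eq_square algebra_simps)
  also have "\<dots> = (\<integral>z. (?gap (fst z))\<^sup>2 \<partial>(PX \<Otimes>\<^sub>M noise))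
      - 2 * (\<integral>z. ?gap (fst z) * snd z \<partial>(PX \<Otimes>\<^sub>M noise))"
    using gap integrable_gap_times_noise[OF assms] by (subst Bochner_Integration.integral_diff) auto
  also have "(\<integral>z. ?gap (fst z) * snd z \<partial>(PX \<Otimes>\<^sub>M noise)) = 0"
    using joint.integral_fst'[OF integrable_gap_times_noise[OF assms]] by (simp add: noise_mean)
  also have "(\<integral>z. (?gap (fst z))\<^sup>2 \<partial>(PX \<Otimes>\<^sub>M noise)) = (\<integral>x. (?gap x)\<^sup>2 \<partial>PX)"
    using joint.integral_fst'[OF gap] using noise.prob_space by simp
  finally show ?thesis by simp
qed

lemma excess_bounds:
  assumes "admissible g"
  shows "0 \<le> excess g" "excess g \<le> 4 * M\<^sup>2"
  using integrable_square_gap[OF assms] square_gap_bound[OF assms]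
  by (auto simp: excess_eq[OF assms] intro: integral_le_const)

text \<open>Since \<open>v = c \<Delta>\<^sup>2\<close> is at most \<open>4 t M\<^sup>2\<close>, the quadratic term \<open>v\<^sup>2 / 2\<close> in the expansion of
  \<open>exp (- v)\<close> is at most \<open>2 t M\<^sup>2 v\<close>: it costs only a fraction of the linear term.\<close>

lemma exp_gap_bound:
  assumes "admissible g" "0 \<le> c" "c \<le> t"
  shows "(\<integral>x. exp (- c * (g x - fstar x)\<^sup>2) \<partial>PX) \<le> exp (- c * (1 - 2 * t * M\<^sup>2) * excess g)"
proof -
  note [measurable] = admissible_measurable[OF assms(1)]
  let ?u = "\<lambda>x. (g x - fstar x)\<^sup>2"
  have pointwise: "exp (- c * ?u x) \<le> 1 - c * (1 - 2 * t * M\<^sup>2) * ?u x" if x: "x \<in> space PX" for x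
  proof -
    have "c * ?u x \<le> t * (4 * M\<^sup>2)"
      using square_gap_bound[OF assms(1) x] assms by (intro mult_mono) auto
    then have "(c * ?u x) * (c * ?u x) \<le> (c * ?u x) * (t * (4 * M\<^sup>2))"
      using assms by (intro mult_left_mono) auto
    moreover have "exp (- (c * ?u x)) \<le> 1 - c * ?u x + (c * ?u x)\<^sup>2 / 2"
      using assms by (intro exp_minus_le_quadratic) auto
    ultimately have "exp (- (c * ?u x)) \<le> 1 - c * ?u x + (c * ?u x) * (t * (4 * M\<^sup>2)) / 2"
      unfolding power2_eq_square[of "c * ?u x"] by linarith
    also have "\<dots> = 1 - c * (1 - 2 * t * M\<^sup>2) * ?u x"
      by (simp add: algebra_simps)
    finally show ?thesis by simp
  qed
  have exp_int: "integrable PX (\<lambda>x. exp (- c * ?u x))"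
    using assms by (intro integrable_const_bound[where B = 1]) auto
  have "(\<integral>x. exp (- c * ?u x) \<partial>PX) \<le> (\<integral>x. 1 - c * (1 - 2 * t * M\<^sup>2) * ?u x \<partial>PX)"
    using integrable_square_gap[OF assms(1)] assms
    by (intro integral_mono pointwise exp_int) auto
  also have "\<dots> = 1 - c * (1 - 2 * t * M\<^sup>2) * excess g"
    using integrable_square_gap[OF assms(1)] by (simp add: excess_eq[OF assms(1)] prob_space)
  also have "\<dots> \<le> exp (- c * (1 - 2 * t * M\<^sup>2) * excess g)"
    using exp_ge_add_one_self[of "- c * (1 - 2 * t * M\<^sup>2) * excess g"] by simp
  finally show ?thesis .
qed

text \<open>The loss difference \<open>\<Delta>\<^sup>2 - 2 \<Delta> \<epsilon>\<close> loses a factor \<open>1 - 2 t \<tau>\<^sup>2\<close> in the exponent through the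
  Gaussian noise and a factor \<open>1 - 2 t M\<^sup>2\<close> through the randomness of \<open>X\<close>.  The
  bound has no separate variance term because the variance of the loss difference is at most a
  constant multiple of its mean.\<close>

lemma exp_loss_diff_bound:
  assumes g: "admissible g" and t: "0 \<le> t" "2 * t * \<tau>\<^sup>2 \<le> 1"
    and a: "1 - a \<le> (1 - 2 * t * \<tau>\<^sup>2) * (1 - 2 * t * M\<^sup>2)"
  shows "(\<integral>\<^sup>+ z. ennreal (exp (t * ((1 - a) * excess g - loss_diff g z))) \<partial>P) \<le> 1"
proof -
  note [measurable] = admissible_measurable[OF g]
  let ?gap = "\<lambda>x. g x - fstar x"
  define c where "c = t * (1 - 2 * t * \<tau>\<^sup>2)"
  have c: "0 \<le> c" "c \<le> t"
    using t by (auto simp: c_def mult_left_le)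
  have noise_integrated: "(\<integral>\<^sup>+ e. ennreal (exp (- t * (?gap x)\<^sup>2 + (2 * t * ?gap x) * e)) \<partial>noise)
      = ennreal (exp (- c * (?gap x)\<^sup>2))" for x
  proof -
    have "(\<integral>\<^sup>+ e. ennreal (exp (- t * (?gap x)\<^sup>2 + (2 * t * ?gap x) * e)) \<partial>noise)
        = (\<integral>\<^sup>+ e. ennreal (exp (- t * (?gap x)\<^sup>2)) * ennreal (exp ((2 * t * ?gap x) * e)) \<partial>noise)"
      by (simp only: exp_add ennreal_mult' exp_ge_zero)
    also have "\<dots> = ennreal (exp (- t * (?gap x)\<^sup>2)) * ennreal (exp ((2 * t * ?gap x)\<^sup>2 * \<tau>\<^sup>2 / 2))"
      by (subst nn_integral_cmult) (simp_all only: nn_integral_exp_normal[OF \<tau>_pos], measurable)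
    also have "\<dots> = ennreal (exp (- c * (?gap x)\<^sup>2))"
      by (simp add: c_def field_simps power2_eq_square flip: ennreal_mult' exp_add)
    finally show ?thesis .
  qed
  have "(\<integral>\<^sup>+ z. ennreal (exp (- t * loss_diff g z)) \<partial>P)
      = (\<integral>\<^sup>+ z. ennreal (exp (- t * (?gap (fst z))\<^sup>2 + (2 * t * ?gap (fst z)) * snd z))
          \<partial>(PX \<Otimes>\<^sub>M noise))"
    unfolding model_law_def loss_diff_def
    by (subst nn_integral_distr)
      (auto intro!: nn_integral_cong simp: split_def power2_eq_square algebra_simps)
  also have "\<dots> = (\<integral>\<^sup>+ x. ennreal (exp (- c * (?gap x)\<^sup>2)) \<partial>PX)"
    by (subst noise.nn_integral_fst[symmetric]) (simp_all only: fst_conv snd_conv noise_integrated, measurable)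
  also have "\<dots> = ennreal (\<integral>x. exp (- c * (?gap x)\<^sup>2) \<partial>PX)"
    using c by (intro nn_integral_eq_integral integrable_const_bound[where B = 1]) auto
  also have "\<dots> \<le> ennreal (exp (- c * (1 - 2 * t * M\<^sup>2) * excess g))"
    by (intro ennreal_leI exp_gap_bound g t c)
  also have "\<dots> \<le> ennreal (exp (- t * (1 - a) * excess g))"
  proof -
    have "t * ((1 - a) * excess g) \<le> t * ((1 - 2 * t * \<tau>\<^sup>2) * (1 - 2 * t * M\<^sup>2) * excess g)"
      using a t excess_bounds(1)[OF g] by (intro mult_left_mono mult_right_mono) auto
    then show ?thesis
      by (intro ennreal_leI) (simp add: c_def mult.assoc)
  qed
  finally have mgf: "(\<integral>\<^sup>+ z. ennreal (exp (- t * loss_diff g z)) \<partial>P)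
      \<le> ennreal (exp (- t * (1 - a) * excess g))" .
  have "(\<integral>\<^sup>+ z. ennreal (exp (t * ((1 - a) * excess g - loss_diff g z))) \<partial>P)
      = (\<integral>\<^sup>+ z. ennreal (exp (t * (1 - a) * excess g)) * ennreal (exp (- t * loss_diff g z)) \<partial>P)"
    by (simp add: algebra_simps flip: ennreal_mult' exp_add)
  also have "\<dots> = ennreal (exp (t * (1 - a) * excess g)) * (\<integral>\<^sup>+ z. ennreal (exp (- t * loss_diff g z)) \<partial>P)"
    using borel_measurable_integrable[OF integrable_loss_diff[OF g]]
    by (intro nn_integral_cmult measurable_compose[OF _ measurable_ennreal]
        measurable_compose[OF _ borel_measurable_exp]) (intro borel_measurable_times; simp)
  also have "\<dots> \<le> ennreal (exp (t * (1 - a) * excess g)) * ennreal (exp (- t * (1 - a) * excess g))"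
    by (intro mult_left_mono mgf) simp
  also have "\<dots> = 1"
    by (simp flip: ennreal_mult' exp_add)
  finally show ?thesis .
qed

section \<open>Selection on an independent sample\<close>

abbreviation sample :: "nat \<Rightarrow> (nat \<Rightarrow> pt \<times> real) measure" where
  "sample n \<equiv> \<Pi>\<^sub>M i\<in>{..<n}. P"

lemma prob_space_sample: "prob_space (sample n)"
  by (intro prob_space_PiM prob_space_P)

lemma sample_mean_loss_diff:
  assumes g: "admissible g" and i: "i < n"
  shows "integrable (sample n) (\<lambda>V. loss_diff g (V i))"
    and "(\<integral>V. loss_diff g (V i) \<partial>sample n) = excess g"
proof -
  have component: "distr (sample n) P (\<lambda>V. V i) = P"
    using distr_PiM_component[of "{..<n}" "\<lambda>_. P" i] i prob_space_P by auto
  have V: "(\<lambda>V. V i) \<in> measurable (sample n) P"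
    using i by (intro measurable_component_singleton) auto
  note meas = borel_measurable_integrable[OF integrable_loss_diff[OF g]]
  show "integrable (sample n) (\<lambda>V. loss_diff g (V i))"
    using integrable_loss_diff[OF g] integrable_distr_eq[OF V meas] component by simp
  show "(\<integral>V. loss_diff g (V i) \<partial>sample n) = excess g"
    using integral_distr[OF V meas] component excess_eq_loss_diff[OF g] by simp
qed

lemma exp_sample_bound:
  fixes n :: nat
  assumes g: "admissible g" and t: "0 \<le> t" "2 * t * \<tau>\<^sup>2 \<le> 1"
    and a: "1 - a \<le> (1 - 2 * t * \<tau>\<^sup>2) * (1 - 2 * t * M\<^sup>2)"
  defines "W \<equiv> \<lambda>V. t * (real n * (1 - a) * excess g - (\<Sum>i<n. loss_diff g (V i)))"
  shows "integrable (sample n) (\<lambda>V. exp (W V))" and "(\<integral>V. exp (W V) \<partial>sample n) \<le> 1"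
proof -
  interpret P: prob_space P by (rule prob_space_P)
  interpret product_sigma_finite "\<lambda>_. P" ..
  note [measurable] = borel_measurable_integrable[OF integrable_loss_diff[OF g]]
  let ?w = "\<lambda>z. t * ((1 - a) * excess g - loss_diff g z)"
  have "ennreal (exp (W V)) = (\<Prod>i<n. ennreal (exp (?w (V i))))" for V
    by (simp add: W_def prod_ennreal sum_subtractf right_diff_distrib sum_distrib_left flip: exp_sum)
  then have "(\<integral>\<^sup>+ V. ennreal (exp (W V)) \<partial>sample n) = (\<Prod>i<n. \<integral>\<^sup>+ z. ennreal (exp (?w z)) \<partial>P)"
    by (simp only:) (intro product_nn_integral_prod; measurable)
  also have "\<dots> \<le> (\<Prod>i<n. 1)"
    using exp_loss_diff_bound[OF g t a] mult_mono[of _ 1 _ "1::ennreal"] by (induction n) (auto simp: mult.commute)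
  finally have le: "(\<integral>\<^sup>+ V. ennreal (exp (W V)) \<partial>sample n) \<le> ennreal 1"
    by simp
  have meas: "(\<lambda>V. exp (W V)) \<in> borel_measurable (sample n)"
    unfolding W_def using sample_mean_loss_diff(1)[OF g]
    by (intro measurable_compose[OF _ borel_measurable_exp] borel_measurable_times
        borel_measurable_diff borel_measurable_sum) auto
  show int: "integrable (sample n) (\<lambda>V. exp (W V))"
    using meas le_less_trans[OF le] by (auto simp: integrable_iff_bounded)
  show "(\<integral>V. exp (W V) \<partial>sample n) \<le> 1"
    using le by (simp add: nn_integral_eq_integral[OF int])
qed

lemma empirical_risk_le_iff:
  assumes "0 < n"
  shows "empirical_risk n V g \<le> empirical_risk n V g' \<longleftrightarrow>
    (\<Sum>i<n. loss_diff g (V i)) \<le> (\<Sum>i<n. loss_diff g' (V i))"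
  using assms by (simp add: empirical_risk_def loss_diff_def sum_subtractf divide_le_cancel)

text \<open>The soft-max bound for the selected member: its deviation \<open>W\<close> is dominated by the sum of the
  exponentials over the whole family, which is a quantity free of the selection \<open>s\<close>.\<close>

lemma selection_oracle_inequality:
  assumes \<Theta>: "finite \<Theta>" "\<theta> \<in> \<Theta>" and n: "0 < n"
    and adm: "\<And>\<theta>. \<theta> \<in> \<Theta> \<Longrightarrow> admissible (g \<theta>)"
    and s_measurable[measurable]: "s \<in> measurable (sample n) (count_space \<Theta>)"
    and minimal: "\<And>V. V \<in> space (sample n) \<Longrightarrow>
      empirical_risk n V (g (s V)) \<le> empirical_risk n V (g \<theta>)"
    and t: "0 < t" "2 * t * \<tau>\<^sup>2 \<le> 1"
    and a: "1 - a \<le> (1 - 2 * t * \<tau>\<^sup>2) * (1 - 2 * t * M\<^sup>2)"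
  shows "(1 - a) * (\<integral>V. excess (g (s V)) \<partial>sample n)
    \<le> excess (g \<theta>) + ln (real (card \<Theta>)) / (real n * t)"
proof -
  interpret S: prob_space "sample n" by (rule prob_space_sample)
  define S where "S \<theta> V = (\<Sum>i<n. loss_diff (g \<theta>) (V i))" for \<theta> V
  define W where "W \<theta> V = t * (real n * (1 - a) * excess (g \<theta>) - S \<theta> V)" for \<theta> V
  define J where "J = real (card \<Theta>)"
  have J: "0 < J"
    using \<Theta> by (auto simp: J_def card_gt_0_iff)
  have s: "s V \<in> \<Theta>" if "V \<in> space (sample n)" for V
    using measurable_space[OF s_measurable that] by simp
  have W_int: "integrable (sample n) (\<lambda>V. exp (W \<theta> V))" "(\<integral>V. exp (W \<theta> V) \<partial>sample n) \<le> 1"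
    if "\<theta> \<in> \<Theta>" for \<theta>
    using exp_sample_bound[OF adm[OF that] _ t(2) a, of n] t(1) unfolding W_def S_def by simp_all
  have S_int: "integrable (sample n) (S \<theta>)" and S_mean: "(\<integral>V. S \<theta> V \<partial>sample n) = real n * excess (g \<theta>)"
    using sample_mean_loss_diff[OF adm[OF \<Theta>(2)]]
    unfolding S_def[abs_def] by (auto simp: Bochner_Integration.integral_sum)
  have excess_int: "integrable (sample n) (\<lambda>V. excess (g (s V)))"
  proof (rule S.integrable_const_bound)
    show "AE V in sample n. norm (excess (g (s V))) \<le> 4 * M\<^sup>2"
      using excess_bounds adm s by (auto intro!: AE_I2)
    show "(\<lambda>V. excess (g (s V))) \<in> borel_measurable (sample n)"
      by (rule measurable_compose[OF s_measurable]) simp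
  qed
  have pointwise: "t * (real n * (1 - a) * excess (g (s V)) - S \<theta> V) - ln J
      \<le> (\<Sum>\<theta>\<in>\<Theta>. exp (W \<theta> V)) / J - 1" if V: "V \<in> space (sample n)" for V
  proof -
    have "S (s V) V \<le> S \<theta> V"
      using minimal[OF V] by (simp add: S_def empirical_risk_le_iff[OF n])
    then have "t * (real n * (1 - a) * excess (g (s V)) - S \<theta> V) - ln J \<le> W (s V) V - ln J"
      using t by (simp add: W_def)
    \<comment> \<open>The shift by \<open>ln J\<close> makes the sum of the \<open>J\<close> exponentials have expectation at most \<open>1\<close>.\<close>
    also have "\<dots> \<le> exp (W (s V) V - ln J) - 1"
      using exp_ge_add_one_self[of "W (s V) V - ln J"] by linarith
    also have "\<dots> = exp (W (s V) V) / J - 1"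
      using J by (simp add: exp_diff)
    also have "\<dots> \<le> (\<Sum>\<theta>\<in>\<Theta>. exp (W \<theta> V)) / J - 1"
      using J s[OF V] \<Theta> member_le_sum[of "s V" \<Theta> "\<lambda>\<theta>. exp (W \<theta> V)"]
      by (simp add: divide_right_mono)
    finally show ?thesis .
  qed
  have "t * (real n * (1 - a) * (\<integral>V. excess (g (s V)) \<partial>sample n) - real n * excess (g \<theta>)) - ln J
      = (\<integral>V. t * (real n * (1 - a) * excess (g (s V)) - S \<theta> V) - ln J \<partial>sample n)"
    using excess_int S_int by (simp add: S_mean S.prob_space)
  also have "\<dots> \<le> (\<integral>V. (\<Sum>\<theta>\<in>\<Theta>. exp (W \<theta> V)) / J - 1 \<partial>sample n)"
    using excess_int S_int W_int(1) by (intro integral_mono pointwise) auto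
  also have "\<dots> = (\<Sum>\<theta>\<in>\<Theta>. \<integral>V. exp (W \<theta> V) \<partial>sample n) / J - 1"
    using W_int(1) by (simp add: S.prob_space)
  also have "\<dots> \<le> 0"
    using J sum_mono[of \<Theta> "\<lambda>\<theta>. \<integral>V. exp (W \<theta> V) \<partial>sample n" "\<lambda>_. 1"] W_int(2)
    by (simp add: J_def)
  finally show ?thesis
    using n t by (simp add: J_def field_simps)
qed

end

section \<open>Estimators trained on independent data\<close>

lemma clip_bound: "0 \<le> M \<Longrightarrow> \<bar>clip M y\<bar> \<le> M"
  by (auto simp: clip_def)

lemma ss_estimator_bound: "0 \<le> M \<Longrightarrow> \<bar>ss_estimator d n m M Q K T U \<theta> x\<bar> \<le> M"
  by (auto simp: ss_estimator_def Let_def split: prod.split intro: clip_bound)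

context bounded_regression
begin

abbreviation data :: "nat \<Rightarrow> nat \<Rightarrow> ((nat \<Rightarrow> pt \<times> real) \<times> (nat \<Rightarrow> pt \<times> real) \<times> (nat \<Rightarrow> pt)) measure" where
  "data n m \<equiv> data_law n m PX fstar \<tau>"

text \<open>For fixed \<open>T\<close> and \<open>U\<close> the trained functions are a deterministic family, so the oracle
  inequality holds conditionally; its right-hand side is constant in \<open>V\<close>.\<close>

lemma trained_selection_oracle_inequality:
  fixes g :: "(nat \<Rightarrow> pt \<times> real) \<Rightarrow> (nat \<Rightarrow> pt) \<Rightarrow> 'i \<Rightarrow> pt \<Rightarrow> real"
  assumes \<Theta>: "finite \<Theta>" "\<theta> \<in> \<Theta>" and n: "0 < n"
    and g_measurable: "\<And>\<theta>. \<theta> \<in> \<Theta> \<Longrightarrow>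
      (\<lambda>((T, V, U), x). g T U \<theta> x) \<in> borel_measurable (data n m \<Otimes>\<^sub>M PX)"
    and g_bound: "\<And>T U \<theta> x. \<bar>g T U \<theta> x\<bar> \<le> M"
    and s_measurable: "(\<lambda>(T, V, U). s T V U) \<in> measurable (data n m) (count_space \<Theta>)"
    and minimal: "\<And>T V U. (T, V, U) \<in> space (data n m) \<Longrightarrow>
      empirical_risk n V (g T U (s T V U)) \<le> empirical_risk n V (g T U \<theta>)"
    and t: "0 < t" "2 * t * \<tau>\<^sup>2 \<le> 1"
    and a: "a < 1" "1 - a \<le> (1 - 2 * t * \<tau>\<^sup>2) * (1 - 2 * t * M\<^sup>2)"
  shows "(\<integral>(T, V, U). excess (g T U (s T V U)) \<partial>data n m)
    \<le> 1 / (1 - a) * ((\<integral>(T, V, U). excess (g T U \<theta>) \<partial>data n m)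
        + ln (real (card \<Theta>)) / (real n * t))"
proof -
  let ?U = "\<Pi>\<^sub>M j\<in>{..<m}. PX"
  have D: "data n m = sample n \<Otimes>\<^sub>M sample n \<Otimes>\<^sub>M ?U"
    by (simp add: data_law_def)
  have prob_U: "prob_space ?U"
    by (intro prob_space_PiM prob_space_axioms)
  interpret S: prob_space "sample n" by (rule prob_space_sample)
  interpret SU: pair_prob_space "sample n" ?U
    using prob_U by (simp add: pair_prob_space_def pair_sigma_finite_def prob_space_imp_sigma_finite
        S.prob_space_axioms)
  interpret D: pair_prob_space "sample n" "sample n \<Otimes>\<^sub>M ?U"
    using SU.prob_space_axioms
    by (simp add: pair_prob_space_def pair_sigma_finite_def prob_space_imp_sigma_finite
        S.prob_space_axioms)
  have space_D: "(T, V, U) \<in> space (data n m) \<longleftrightarrow>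
      T \<in> space (sample n) \<and> V \<in> space (sample n) \<and> U \<in> space ?U" for T V U
    by (simp add: D space_pair_measure)
  have adm: "admissible (g T U \<theta>)"
    if "\<theta> \<in> \<Theta>" "(T, V, U) \<in> space (data n m)" for \<theta> T V U
    using measurable_compose[OF measurable_Pair1'[OF that(2)] g_measurable[OF that(1)]] g_bound
    by (simp add: admissible_def)
  have s: "s T V U \<in> \<Theta>" if "(T, V, U) \<in> space (data n m)" for T V U
    using measurable_space[OF s_measurable that] by simp
  have excess_measurable: "(\<lambda>(T, V, U). excess (g T U \<theta>)) \<in> borel_measurable (data n m)"
    if "\<theta> \<in> \<Theta>" for \<theta>
  proof -
    note [measurable] = g_measurable[OF that]
    have "(\<lambda>w. \<integral>x. ((\<lambda>((T, V, U), x). g T U \<theta> x) (w, x) - fstar x)\<^sup>2 \<partial>PX)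
        \<in> borel_measurable (data n m)"
      by measurable
    then show ?thesis
      by (rule measurable_cong[THEN iffD1, rotated]) (auto simp: excess_eq[OF adm[OF that]])
  qed
  have selected_measurable:
    "(\<lambda>(T, V, U). excess (g T U (s T V U))) \<in> borel_measurable (data n m)"
    using measurable_compose_countable'[OF excess_measurable s_measurable] \<Theta>(1)
    by (simp add: split_def countable_finite)
  have slice: "(\<integral>V. excess (g T U (s T V U)) \<partial>sample n)
      \<le> 1 / (1 - a) * (excess (g T U \<theta>) + ln (real (card \<Theta>)) / (real n * t))"
    if T: "T \<in> space (sample n)" and U: "U \<in> space ?U" for T U
  proof -
    obtain V0 where V0: "V0 \<in> space (sample n)"
      using S.not_empty by blast
    have "(\<lambda>V. (T, V, U)) \<in> measurable (sample n) (data n m)"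
      using T U by (simp add: D)
    then have "(\<lambda>V. s T V U) \<in> measurable (sample n) (count_space \<Theta>)"
      using measurable_compose[OF _ s_measurable, of "\<lambda>V. (T, V, U)"] by simp
    then have "(1 - a) * (\<integral>V. excess (g T U (s T V U)) \<partial>sample n)
        \<le> excess (g T U \<theta>) + ln (real (card \<Theta>)) / (real n * t)"
    proof (intro selection_oracle_inequality \<Theta> n t a)
      show "admissible (g T U \<theta>)" if "\<theta> \<in> \<Theta>" for \<theta>
        using adm[OF that, of T V0 U] T U V0 by (simp add: space_D)
      show "empirical_risk n V (g T U (s T V U)) \<le> empirical_risk n V (g T U \<theta>)"
        if "V \<in> space (sample n)" for V
        using minimal T U that by (simp add: space_D)
    qed
    then show ?thesis
      using a(1) by (simp add: field_simps)
  qed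
  let ?c = "ln (real (card \<Theta>)) / (real n * t)"
  \<comment> \<open>A common bound for both sides, needed for the integrability behind Fubini's theorem.\<close>
  define b where "b = 1 / (1 - a) * (4 * M\<^sup>2 + ?c) + 4 * M\<^sup>2"
  have c: "0 \<le> ?c"
    using \<Theta> t n card_gt_0_iff[of \<Theta>] by (auto intro!: divide_nonneg_nonneg ln_ge_zero)
  have "(\<integral>(T, V, U). excess (g T U (s T V U)) \<partial>data n m)
      \<le> (\<integral>(T, V, U). 1 / (1 - a) * (excess (g T U \<theta>) + ?c) \<partial>data n m)"
    unfolding D
  proof (rule integral_mono_conditional[where b = b])
    show "prob_space (sample n)" "prob_space (sample n)" "prob_space ?U"
      by (fact S.prob_space_axioms prob_U)+
    show "(\<lambda>(T, V, U). excess (g T U (s T V U))) \<in> borel_measurable (sample n \<Otimes>\<^sub>M sample n \<Otimes>\<^sub>M ?U)"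
      using selected_measurable by (simp add: D)
    show "(\<lambda>(T, V, U). 1 / (1 - a) * (excess (g T U \<theta>) + ?c))
        \<in> borel_measurable (sample n \<Otimes>\<^sub>M sample n \<Otimes>\<^sub>M ?U)"
      using excess_measurable[OF \<Theta>(2)] by (simp add: D split_def)
  next
    fix z assume "z \<in> space (sample n \<Otimes>\<^sub>M sample n \<Otimes>\<^sub>M ?U)"
    then obtain T V U where z: "z = (T, V, U)" "(T, V, U) \<in> space (data n m)"
      by (cases z) (auto simp: D)
    have "0 \<le> 1 / (1 - a) * (4 * M\<^sup>2 + ?c)"
      using c a(1) by simp
    then show "\<bar>case z of (T, V, U) \<Rightarrow> excess (g T U (s T V U))\<bar> \<le> b"
      using excess_bounds[OF adm[OF s[OF z(2)] z(2)]] by (simp add: z(1) b_def)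
    have e: "0 \<le> excess (g T U \<theta>)" "excess (g T U \<theta>) \<le> 4 * M\<^sup>2"
      using excess_bounds[OF adm[OF \<Theta>(2) z(2)]] by auto
    then have "0 \<le> 1 / (1 - a) * (excess (g T U \<theta>) + ?c)"
      using c a(1) by simp
    moreover have "1 / (1 - a) * (excess (g T U \<theta>) + ?c) \<le> 1 / (1 - a) * (4 * M\<^sup>2 + ?c)"
      using e a(1) by (intro mult_left_mono) auto
    ultimately show "\<bar>case z of (T, V, U) \<Rightarrow> 1 / (1 - a) * (excess (g T U \<theta>) + ?c)\<bar> \<le> b"
      unfolding z(1) b_def prod.case
      using zero_le_power2[of M] by linarith
  next
    fix T U assume "T \<in> space (sample n)" "U \<in> space ?U"
    then show "(\<integral>V. (case (T, V, U) of (T, V, U) \<Rightarrow> excess (g T U (s T V U))) \<partial>sample n)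
        \<le> (\<integral>V. (case (T, V, U) of (T, V, U) \<Rightarrow> 1 / (1 - a) * (excess (g T U \<theta>) + ?c)) \<partial>sample n)"
      using slice by (simp add: S.prob_space)
  qed
  also have "\<dots> = 1 / (1 - a) * ((\<integral>(T, V, U). excess (g T U \<theta>) \<partial>data n m) + ?c)"
  proof -
    interpret data: prob_space "data n m"
      unfolding D by (rule D.prob_space_axioms)
    have "integrable (data n m) (\<lambda>(T, V, U). excess (g T U \<theta>))"
      unfolding D
    proof (rule D.integrable_const_bound)
      show "AE z in sample n \<Otimes>\<^sub>M sample n \<Otimes>\<^sub>M ?U.
          norm (case z of (T, V, U) \<Rightarrow> excess (g T U \<theta>)) \<le> 4 * M\<^sup>2"
        using excess_bounds[OF adm[OF \<Theta>(2)]] by (auto intro!: AE_I2 simp flip: D)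
    qed (use excess_measurable[OF \<Theta>(2)] in \<open>simp add: D\<close>)
    then show ?thesis
      by (simp add: split_def data.prob_space)
  qed
  finally show ?thesis .
qed

end


section \<open>The oracle inequality for semisupervised kernel estimators\<close>

theorem theorem6p1:
  fixes M \<tau> :: real
  assumes "0 < M" and "0 < \<tau>"
  shows "\<exists>a t :: real. 0 < a \<and> a < 1 \<and> 0 < t \<and> t < 15 / (38 * (M\<^sup>2 + \<tau>\<^sup>2)) \<and>
    (\<forall>(d :: nat) (n :: nat) (m :: nat) (PX :: pt measure) (fstar :: pt \<Rightarrow> real)
       (Q :: real \<Rightarrow> real) (K :: real \<Rightarrow> real) (Hs :: real set) (As :: real set) (Ss :: real set)
       (\<Theta> :: (real \<times> real \<times> real) set) (J :: nat)
       (\<theta>hat :: (nat \<Rightarrow> pt \<times> real) \<Rightarrow> (nat \<Rightarrow> pt \<times> real) \<Rightarrow> (nat \<Rightarrow> pt) \<Rightarrow> real \<times> real \<times> real)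
       (\<delta> :: real).
       let D = data_law n m PX fstar \<tau>;
           fhat = ss_estimator d n m M Q K;
           \<E> = excess_risk PX fstar \<tau>
       in
         0 < d \<and> 0 < n \<and> 0 < m \<and>
         prob_space PX \<and> sets PX = sets (cube d) \<and>
         fstar \<in> borel_measurable PX \<and> (\<forall>x\<in>space PX. \<bar>fstar x\<bar> \<le> M) \<and>
         weight_kernel Q \<and> density_kernel d K \<and>
         finite Hs \<and> Hs \<noteq> {} \<and> Hs \<subseteq> {0<..} \<and>
         finite As \<and> As \<noteq> {} \<and> As \<subseteq> {0..} \<and>
         finite Ss \<and> Ss \<noteq> {} \<and> Ss \<subseteq> {0<..} \<and>
         \<Theta> = Hs \<times> As \<times> Ss \<and> J = card \<Theta> \<and>
         (\<forall>\<theta>\<in>\<Theta>. (\<lambda>((T, V, U), x). fhat T U \<theta> x) \<in> borel_measurable (D \<Otimes>\<^sub>M PX)) \<and>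
         (\<lambda>(T, V, U). \<theta>hat T V U) \<in> measurable D (count_space \<Theta>) \<and>
         (\<forall>(T, V, U)\<in>space D.
            is_arg_min (\<lambda>\<theta>. empirical_risk n V (fhat T U \<theta>)) (\<lambda>\<theta>. \<theta> \<in> \<Theta>) (\<theta>hat T V U)) \<and>
         0 < \<delta> \<and> \<delta> < 1
         \<longrightarrow>
         (\<integral>(T, V, U). \<E> (fhat T U (\<theta>hat T V U)) \<partial>D)
           \<le> 1 / (1 - a) *
               ((MIN \<theta>\<in>\<Theta>. \<integral>(T, V, U). \<E> (fhat T U \<theta>) \<partial>D) + ln (real J / \<delta>) / (real n * t))
             + 4 * \<delta> * M\<^sup>2)"
proof -
  \<comment> \<open>This \<open>t\<close> makes each of the two loss factors at least \<open>3/4\<close>, and \<open>(3/4)\<^sup>2 \<ge> 1/2\<close>.\<close>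
  define a :: real where "a = 1 / 2"
  define t :: real where "t = 1 / (8 * (M\<^sup>2 + \<tau>\<^sup>2))"
  have pos: "0 < M\<^sup>2" "0 < \<tau>\<^sup>2"
    using assms by simp_all
  have t_pos: "0 < t"
    using add_pos_pos[OF pos] by (simp add: t_def)
  have t_upper: "t < 15 / (38 * (M\<^sup>2 + \<tau>\<^sup>2))"
  proof -
    have "1 / (8 * r) < 15 / (38 * r)" if "0 < r" for r :: real
      using that by (simp add: field_simps)
    then show ?thesis
      unfolding t_def using add_pos_pos[OF pos] by blast
  qed
  have quarter: "2 * t * \<tau>\<^sup>2 \<le> 1 / 4" "2 * t * M\<^sup>2 \<le> 1 / 4"
    using pos add_pos_pos[OF pos] by (simp_all add: t_def pos_divide_le_eq)
  have "(3 / 4) * (3 / 4) \<le> (1 - 2 * t * \<tau>\<^sup>2) * (1 - 2 * t * M\<^sup>2)"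
    using quarter by (intro mult_mono) auto
  then have a: "1 - a \<le> (1 - 2 * t * \<tau>\<^sup>2) * (1 - 2 * t * M\<^sup>2)"
    by (simp add: a_def)
  show ?thesis
  proof (rule exI[of _ a], rule exI[of _ t], intro conjI allI)
    show "0 < a" "a < 1" by (simp_all add: a_def)
  next
    fix d n m :: nat and PX :: "pt measure" and fstar :: "pt \<Rightarrow> real" and Q K :: "real \<Rightarrow> real"
      and Hs As Ss :: "real set" and \<Theta> :: "(real \<times> real \<times> real) set" and J :: nat
      and \<theta>hat :: "(nat \<Rightarrow> pt \<times> real) \<Rightarrow> (nat \<Rightarrow> pt \<times> real) \<Rightarrow> (nat \<Rightarrow> pt) \<Rightarrow> real \<times> real \<times> real"
      and \<delta> :: real
    define D where "D = data_law n m PX fstar \<tau>"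
    define fhat where "fhat = ss_estimator d n m M Q K"
    define R where "R \<theta> = (\<integral>(T, V, U). excess_risk PX fstar \<tau> (fhat T U \<theta>) \<partial>D)" for \<theta>
    have main: "(\<integral>(T, V, U). excess_risk PX fstar \<tau> (fhat T U (\<theta>hat T V U)) \<partial>D)
        \<le> 1 / (1 - a) * ((MIN \<theta>\<in>\<Theta>. R \<theta>) + ln (real J / \<delta>) / (real n * t)) + 4 * \<delta> * M\<^sup>2"
      if n: "0 < n" and PX: "prob_space PX"
        and fstar: "fstar \<in> borel_measurable PX" "\<forall>x\<in>space PX. \<bar>fstar x\<bar> \<le> M"
        and \<Theta>: "finite \<Theta>" "\<Theta> \<noteq> {}" "J = card \<Theta>"
        and fhat_measurable: "\<forall>\<theta>\<in>\<Theta>. (\<lambda>((T, V, U), x). fhat T U \<theta> x) \<in> borel_measurable (D \<Otimes>\<^sub>M PX)"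
        and \<theta>hat_measurable: "(\<lambda>(T, V, U). \<theta>hat T V U) \<in> measurable D (count_space \<Theta>)"
        and minimal: "\<forall>(T, V, U)\<in>space D.
          is_arg_min (\<lambda>\<theta>. empirical_risk n V (fhat T U \<theta>)) (\<lambda>\<theta>. \<theta> \<in> \<Theta>) (\<theta>hat T V U)"
        and \<delta>: "0 < \<delta>" "\<delta> < 1"
    proof -
      interpret prob_space PX by fact
      interpret bounded_regression PX fstar \<tau> M
        using fstar assms by unfold_locales auto
      have "(MIN \<theta>\<in>\<Theta>. R \<theta>) \<in> R ` \<Theta>"
        using \<Theta> by (intro Min_in) auto
      then obtain \<theta> where \<theta>: "\<theta> \<in> \<Theta>" "(MIN \<theta>\<in>\<Theta>. R \<theta>) = R \<theta>"
        by auto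
      have J: "0 < real J"
        using \<Theta> by (simp add: card_gt_0_iff)
      have "(\<integral>(T, V, U). excess (fhat T U (\<theta>hat T V U)) \<partial>D)
          \<le> 1 / (1 - a) * (R \<theta> + ln (real (card \<Theta>)) / (real n * t))"
        unfolding R_def D_def
      proof (rule trained_selection_oracle_inequality[OF \<Theta>(1) \<theta>(1) n _ _ _ _ t_pos _ _ a])
        show "\<bar>fhat T U \<theta> x\<bar> \<le> M" for T U \<theta> x
          using assms(1) by (simp add: fhat_def ss_estimator_bound)
        show "empirical_risk n V (fhat T U (\<theta>hat T V U)) \<le> empirical_risk n V (fhat T U \<theta>)"
          if "(T, V, U) \<in> space (data n m)" for T V U
          using bspec[OF minimal, of "(T, V, U)"] that \<theta>(1)
          by (cases \<theta>) (simp add: D_def is_arg_min_linorder)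
      qed (use fhat_measurable \<theta>hat_measurable quarter in \<open>auto simp: D_def a_def\<close>)
      also have "\<dots> \<le> 1 / (1 - a) * (R \<theta> + ln (real J / \<delta>) / (real n * t))"
      proof -
        have "real J \<le> real J / \<delta>"
          using J \<delta> by (simp add: le_divide_eq)
        then have "ln (real J) \<le> ln (real J / \<delta>)"
          using J by simp
        then show ?thesis
          using n t_pos \<Theta>(3) by (simp add: a_def divide_right_mono)
      qed
      also have "\<dots> \<le> 1 / (1 - a) * (R \<theta> + ln (real J / \<delta>) / (real n * t)) + 4 * \<delta> * M\<^sup>2"
        using \<delta> by simp
      finally show ?thesis
        by (simp add: \<theta>(2))
    qed
    show "let D = data_law n m PX fstar \<tau>;
           fhat = ss_estimator d n m M Q K;
           \<E> = excess_risk PX fstar \<tau>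
       in
         0 < d \<and> 0 < n \<and> 0 < m \<and>
         prob_space PX \<and> sets PX = sets (cube d) \<and>
         fstar \<in> borel_measurable PX \<and> (\<forall>x\<in>space PX. \<bar>fstar x\<bar> \<le> M) \<and>
         weight_kernel Q \<and> density_kernel d K \<and>
         finite Hs \<and> Hs \<noteq> {} \<and> Hs \<subseteq> {0<..} \<and>
         finite As \<and> As \<noteq> {} \<and> As \<subseteq> {0..} \<and>
         finite Ss \<and> Ss \<noteq> {} \<and> Ss \<subseteq> {0<..} \<and>
         \<Theta> = Hs \<times> As \<times> Ss \<and> J = card \<Theta> \<and>
         (\<forall>\<theta>\<in>\<Theta>. (\<lambda>((T, V, U), x). fhat T U \<theta> x) \<in> borel_measurable (D \<Otimes>\<^sub>M PX)) \<and>
         (\<lambda>(T, V, U). \<theta>hat T V U) \<in> measurable D (count_space \<Theta>) \<and>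
         (\<forall>(T, V, U)\<in>space D.
            is_arg_min (\<lambda>\<theta>. empirical_risk n V (fhat T U \<theta>)) (\<lambda>\<theta>. \<theta> \<in> \<Theta>) (\<theta>hat T V U)) \<and>
         0 < \<delta> \<and> \<delta> < 1
         \<longrightarrow>
         (\<integral>(T, V, U). \<E> (fhat T U (\<theta>hat T V U)) \<partial>D)
           \<le> 1 / (1 - a) *
               ((MIN \<theta>\<in>\<Theta>. \<integral>(T, V, U). \<E> (fhat T U \<theta>) \<partial>D) + ln (real J / \<delta>) / (real n * t))
             + 4 * \<delta> * M\<^sup>2"
      unfolding Let_def D_def[symmetric] fhat_def[symmetric] R_def[symmetric]
      by (intro impI, elim conjE, rule main) (assumption | simp)+
  qed (fact t_pos t_upper)+
qed

end
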